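(* Let $(\mathcal{H}_+;\mathcal{H}_0;\mathcal{H}_-)$ be a triplet of closely embedded Hilbert spaces, and let $j_+$ and $j_-$ denote the corresponding closed embeddings of $\mathcal{H}_+$ in $\mathcal{H}_0$ and, respectively, of $\mathcal{H}_0$ in $\mathcal{H}_-$. Then: (a) The kernel operator $A=j_+j_+^*$ is positive selfadjoint in $\mathcal{H}_0$ and $0$ is not an eigenvalue of $A$. Also, the Hamiltonian operator $H=A^{-1}$ is a positive selfadjoint operator in $\mathcal{H}_0$ for which $0$ is not an eigenvalue. (b) $\operatorname{Dom}(j_+^* )=\operatorname{Dom}(j_-)$, the closed embeddings $j_+$ and $j_-$ are simultaneously continuous or not, and the operator $V=j_+^*\colon\operatorname{Dom}(j_+^* )\,(\subseteq\mathcal{H}_-)\to\mathcal{H}_+$ extends uniquely to a unitary operator $\widetilde V\colon\mathcal{H}_-\to\mathcal{H}_+$. (c) The kernel operator $A$ can be viewed as an operator densely defined in $\mathcal{H}_-$ with dense range in $\mathcal{H}_+$, and it is a restriction of the unitary operator $\widetilde V$. (d) The Hamiltonian operator $H$ can be viewed as an operator densely defined in $\mathcal{H}_+$ with range dense in $\mathcal{H}_-$, and it is uniquely extended to a unitary operator $\widetilde H\colon\mathcal{H}_+\to\mathcal{H}_-$, and $\widetilde H=\widetilde V^{-1}$. (e) The operator $\Theta$ defined by $(\Theta y)(x)=\langle\widetilde Vy,x\rangle_+$, for all $y\in\mathcal{H}_-$ and all $x\in\mathcal{H}_+$, provides a unitary identification of $\mathcal{H}_-$ with the conjugate dual space $\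mathcal{H}_+^*$.
   Context: All Hilbert spaces are complex, with inner products linear in the first variable; operators may be unbounded. "Positive" means $\langle Ax,x\rangle\ge 0$ on the domain. For an injective operator $S$, $S^{-1}$ is its algebraic inverse, with $\operatorname{Dom}(S^{-1})=\operatorname{Ran}(S)$. The norms and inner products of $\mathcal{H}_\pm$ are denoted $\|\cdot\|_\pm$, $\langle\cdot,\cdot\rangle_\pm$. The conjugate dual $\mathcal{H}_+^*$ is the space of continuous conjugate-linear functionals on $\mathcal{H}_+$ with the dual norm. A Hilbert space $\mathcal{K}$ is closely embedded in a Hilbert space $\mathcal{H}$ if there is a linear manifold $\mathcal{D}\subseteq\mathcal{K}\cap\mathcal{H}$ (on which the algebraic structures of $\mathcal{K}$ and $\mathcal{H}$ agree), dense in $\mathcal{K}$, such that the embedding operator $j$ with $\operatorname{Dom}(j)=\mathcal{D}$, $jx=x$, is closed as an operator from $\mathcal{K}$ to $\mathcal{H}$; $j$ is called the closed embedding. $(\mathcal{H}_+;\mathcal{H}_0;\mathcal{H}_-)$ is a triplet of closely embedded Hilbert spaces if: (th1) $\mathcal{H}_+$ is a Hilbert space closely embedded in the Hilbert space $\mathcal{H}_0$, with closed embedding $j_+$, and $\operatorname{Ran}(j_+)$ is dense in $\mathcal{H}_0$; (th2) $\mathcal{H}_0$ is closely embedded in the Hilbert space $\mathcal{H}_-$, with closed embedding $j_-$, and $\operatorname{Ran}(j_-)$ is dense in $\mathcal{H}_-$; (th3) $\operatorname{Dom}(j_+^* )\subseteq\operatorname{Dom}(j_-)$ and for every $y\in\operatorname{Dom}(j_-)\subseteq\mathcal{H}_0$,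 $$\|y\|_-=\sup\Bigl\{\frac{|\langle x,y\rangle_{\mathcal{H}_0}|}{\|x\|_+}\;\Big|\; x\in\operatorname{Dom}(j_+),\ x\ne0\Bigr\}.$$ Vectors of $\operatorname{Dom}(j_+)$ are identified with their images in $\mathcal{H}_0$, and vectors of $\operatorname{Dom}(j_-)$ with their images in $\mathcal{H}_-$; in particular $\operatorname{Dom}(j_+^* )\subseteq\operatorname{Dom}(j_-)$ is regarded as a subspace of $\mathcal{H}_-$. *)

theory Defs
  imports "HOL-Analysis.Analysis"
begin

text \<open>
  A complex Hilbert space is a complete real inner product space with a compatible complex
  structure.  The complex inner product is linear in the first variable, and the real one is its
  real part, so that the library norm satisfies \<open>(norm x)\<^sup>2 = cinner x x\<close>; definiteness and
  positivity of \<open>cinner\<close> are therefore inherited from \<open>real_inner\<close>.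
\<close>

class complex_hilbert = real_inner + complete_space +
  fixes scaleC :: "complex \<Rightarrow> 'a \<Rightarrow> 'a"  (infixr "*\<^sub>C" 75)
    and cinner :: "'a \<Rightarrow> 'a \<Rightarrow> complex"
  assumes scaleC_add_right: "c *\<^sub>C (x + y) = c *\<^sub>C x + c *\<^sub>C y"
    and scaleC_add_left: "(c + d) *\<^sub>C x = c *\<^sub>C x + d *\<^sub>C x"
    and scaleC_scaleC: "c *\<^sub>C d *\<^sub>C x = (c * d) *\<^sub>C x"
    and scaleR_scaleC: "r *\<^sub>R x = complex_of_real r *\<^sub>C x"
    and cinner_commute: "cinner x y = cnj (cinner y x)"
    and cinner_add_left: "cinner (x + y) z = cinner x z + cinner y z"
    and cinner_scaleC_left: "cinner (c *\<^sub>C x) y = c * cinner x y"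
    and inner_eq_Re_cinner: "inner x y = Re (cinner x y)"

instantiation complex :: complex_hilbert
begin

definition scaleC_complex :: "complex \<Rightarrow> complex \<Rightarrow> complex"
  where "scaleC_complex c x = c * x"

definition cinner_complex :: "complex \<Rightarrow> complex \<Rightarrow> complex"
  where "cinner_complex x y = x * cnj y"

instance
  by standard
    (auto simp: scaleC_complex_def cinner_complex_def algebra_simps scaleR_conv_of_real
      inner_complex_def)

end

text \<open>
  Unbounded operators from \<open>'a\<close> to \<open>'b\<close> are represented by their graphs.  Hence \<open>Domain\<close> and
  \<open>Range\<close> are the domain and the range, \<open>S O T\<close> is the product ``first \<open>S\<close>, then \<open>T\<close>'' on its
  maximal domain, \<open>T\<inverse>\<close> is the algebraic inverse of an injective \<open>T\<close>, \<open>S \<subseteq> T\<close> says that \<open>T\<close>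
  extends \<open>S\<close>, and \<open>T\<close> is a closed operator iff \<open>closed T\<close>.
\<close>

definition linear_operator :: "('a::complex_hilbert \<times> 'b::complex_hilbert) set \<Rightarrow> bool" where
  "linear_operator T \<longleftrightarrow>
     single_valued T \<and>
     (0, 0) \<in> T \<and>
     (\<forall>x y x' y'. (x, y) \<in> T \<longrightarrow> (x', y') \<in> T \<longrightarrow> (x + x', y + y') \<in> T) \<and>
     (\<forall>c x y. (x, y) \<in> T \<longrightarrow> (c *\<^sub>C x, c *\<^sub>C y) \<in> T)"

definition dense :: "'a::topological_space set \<Rightarrow> bool" where
  "dense S \<longleftrightarrow> closure S = UNIV"

definition apply_operator :: "('a \<times> 'b) set \<Rightarrow> 'a \<Rightarrow> 'b" where
  "apply_operator T x = (THE y. (x, y) \<in> T)"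

definition continuous_operator ::
    "('a::complex_hilbert \<times> 'b::complex_hilbert) set \<Rightarrow> bool" where
  "continuous_operator T \<longleftrightarrow> continuous_on (Domain T) (apply_operator T)"

text \<open>The graph of the Hilbert space adjoint; it is single-valued iff \<open>Domain T\<close> is dense.\<close>

definition adjoint_operator ::
    "('a::complex_hilbert \<times> 'b::complex_hilbert) set \<Rightarrow> ('b \<times> 'a) set" where
  "adjoint_operator T = {(y, z). \<forall>(x, w) \<in> T. cinner w y = cinner x z}"

definition selfadjoint :: "('a::complex_hilbert \<times> 'a) set \<Rightarrow> bool" where
  "selfadjoint A \<longleftrightarrow> linear_operator A \<and> dense (Domain A) \<and> adjoint_operator A = A"

definition positive_operator :: "('a::complex_hilbert \<times> 'a) set \<Rightarrow> bool" where
  "positive_operator A \<longleftrightarrow> (\<forall>(x, y) \<in> A. cinner y x \<in> \<real>\<^sub>\<ge>\<^sub>0)"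

definition eigenvalue :: "('a::complex_hilbert \<times> 'a) set \<Rightarrow> complex \<Rightarrow> bool" where
  "eigenvalue A c \<longleftrightarrow> (\<exists>x. x \<noteq> 0 \<and> (x, c *\<^sub>C x) \<in> A)"

definition unitary :: "('a::complex_hilbert \<Rightarrow> 'b::complex_hilbert) \<Rightarrow> bool" where
  "unitary U \<longleftrightarrow>
     (\<forall>x y. U (x + y) = U x + U y) \<and>
     (\<forall>c x. U (c *\<^sub>C x) = c *\<^sub>C U x) \<and>
     (\<forall>x y. cinner (U x) (U y) = cinner x y) \<and>
     surj U"

definition graph_of :: "('a \<Rightarrow> 'b) \<Rightarrow> ('a \<times> 'b) set" where
  "graph_of f = {(x, y). y = f x}"

definition extends_to_unitary ::
    "('a::complex_hilbert \<times> 'b::complex_hilbert) set \<Rightarrow> ('a \<Rightarrow> 'b) \<Rightarrow> bool" where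
  "extends_to_unitary T U \<longleftrightarrow> unitary U \<and> T \<subseteq> graph_of U"

text \<open>
  The two Hilbert spaces live on different types, so the linear manifold in their intersection, on
  which the embedding acts as \<open>x \<mapsto> x\<close>, becomes a linear manifold \<open>Domain j\<close> of \<open>'k\<close> together with
  the injective linear map \<open>j\<close> that identifies its elements with elements of \<open>'h\<close>.
\<close>

definition closed_embedding ::
    "('k::complex_hilbert \<times> 'h::complex_hilbert) set \<Rightarrow> bool" where
  "closed_embedding j \<longleftrightarrow>
     linear_operator j \<and> single_valued (j\<inverse>) \<and> dense (Domain j) \<and> closed j"

text \<open>
  In the last clause \<open>v\<close> is \<open>y\<close> regarded as a vector of the third space and \<open>x'\<close> is \<open>x\<close> regarded as
  a vector of the second one.  The supremum is taken in \<open>ennreal\<close>, so it is \<open>0\<close> over the empty set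
  (all three spaces are zero), and the equation includes that it is finite.
\<close>

definition closely_embedded_triplet ::
    "('p::complex_hilbert \<times> 'o::complex_hilbert) set \<Rightarrow>
     ('o \<times> 'm::complex_hilbert) set \<Rightarrow> bool" where
  "closely_embedded_triplet jp jm \<longleftrightarrow>
     closed_embedding jp \<and> dense (Range jp) \<and>
     closed_embedding jm \<and> dense (Range jm) \<and>
     Domain (adjoint_operator jp) \<subseteq> Domain jm \<and>
     (\<forall>(y, v) \<in> jm. ennreal (norm v) =
        (SUP (x, x') \<in> {(x, x'). (x, x') \<in> jp \<and> x \<noteq> 0}. ennreal (cmod (cinner x' y) / norm x)))"

definition kernel_operator ::
    "('p::complex_hilbert \<times> 'o::complex_hilbert) set \<Rightarrow> ('o \<times> 'o) set" where
  "kernel_operator jp = adjoint_operator jp O jp"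

definition hamiltonian ::
    "('p::complex_hilbert \<times> 'o::complex_hilbert) set \<Rightarrow> ('o \<times> 'o) set" where
  "hamiltonian jp = (kernel_operator jp)\<inverse>"

text \<open>
  Carried with \<open>onorm\<close>, which on these (real-linear, bounded) functionals is the dual norm.
\<close>

definition conjugate_dual :: "('a::complex_hilbert \<Rightarrow> complex) set" where
  "conjugate_dual = {f. continuous_on UNIV f \<and>
     (\<forall>x y. f (x + y) = f x + f y) \<and> (\<forall>c x. f (c *\<^sub>C x) = cnj c * f x)}"

text \<open>
  A linear isometry of a Hilbert space onto the conjugate dual, whose linear structure is the
  pointwise one; the dual norm determines the inner product by polarization.
\<close>

definition unitary_onto_conjugate_dual ::
    "('m::complex_hilbert \<Rightarrow> 'p::complex_hilbert \<Rightarrow> complex) \<Rightarrow> bool" where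
  "unitary_onto_conjugate_dual \<Theta> \<longleftrightarrow>
     (\<forall>y z. \<Theta> (y + z) = (\<lambda>x. \<Theta> y x + \<Theta> z x)) \<and>
     (\<forall>c y. \<Theta> (c *\<^sub>C y) = (\<lambda>x. c * \<Theta> y x)) \<and>
     (\<forall>y. onorm (\<Theta> y) = norm y) \<and>
     bij_betw \<Theta> UNIV conjugate_dual"

end

theory Submission
  imports Defs
begin

text \<open>
  Decomposing \<open>(0, h)\<close> orthogonally along the closed graph of \<open>j\<^sub>+\<close> gives \<open>h = y + A y\<close>, so
  \<open>1 + A\<close> is onto; by the symmetry of the equation \<open>h = y + w\<close> in \<open>y\<close> and \<open>w = A y\<close>, so is
  \<open>1 + A\<^sup>-\<^sup>1\<close>.  A positive symmetric operator with this property is selfadjoint.  Condition (th3) says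
  that \<open>\<parallel>y\<parallel>\<^sub>-\<close> is the norm of the functional \<open>x \<mapsto> \<langle>x, y\<rangle>\<close> on \<open>Dom(j\<^sub>+) \<subseteq> H\<^sub>+\<close>, hence, by Riesz, that
  \<open>y\<close> lies in the domain of \<open>j\<^sub>+\<^sup>*\<close> and that \<open>j\<^sub>+\<^sup>*\<close> is isometric for the norm of \<open>H\<^sub>-\<close>; everything
  else follows from extending isometries with dense domain and dense range.
\<close>

section \<open>Complex Hilbert spaces\<close>

lemma scaleC_zero_left [simp]: "0 *\<^sub>C x = (0::'a::complex_hilbert)"
  using scaleR_scaleC[of 0 x] by simp

lemma scaleC_minus_one: "(-1) *\<^sub>C x = - (x::'a::complex_hilbert)"
  using scaleR_scaleC[of "-1" x] by simp

lemma cinner_zero_left [simp]: "cinner 0 y = 0"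
  using cinner_add_left[of 0 0 y] by simp

lemma cinner_zero_right [simp]: "cinner y 0 = 0"
  using cinner_commute[of y 0] by simp

lemma cinner_add_right: "cinner x (y + z) = cinner x y + cinner x z"
  by (metis cinner_add_left cinner_commute complex_cnj_add)

lemma cinner_scaleC_right: "cinner x (c *\<^sub>C y) = cnj c * cinner x y"
  by (metis cinner_commute cinner_scaleC_left complex_cnj_mult)

lemma cinner_minus_left [simp]: "cinner (- x) y = - cinner x y"
  by (metis add.right_inverse add_eq_0_iff cinner_add_left cinner_zero_left)

lemma cinner_minus_right [simp]: "cinner x (- y) = - cinner x y"
  by (metis cinner_commute cinner_minus_left complex_cnj_minus)

lemma cinner_diff_left: "cinner (x - y) z = cinner x z - cinner y z"
  using cinner_add_left[of x "- y" z] by simp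

lemma cinner_diff_right: "cinner x (y - z) = cinner x y - cinner x z"
  using cinner_add_right[of x y "- z"] by simp

lemma cinner_self: "cinner x x = complex_of_real ((norm x)\<^sup>2)"
proof -
  have "Im (cinner x x) = 0"
    using arg_cong[OF cinner_commute[of x x], of Im] by simp
  then show ?thesis
    by (simp add: complex_eq_iff power2_norm_eq_inner inner_eq_Re_cinner)
qed

lemma cinner_eq_zero_iff [simp]: "cinner x x = 0 \<longleftrightarrow> x = 0"
  by (simp add: cinner_self)

lemma norm_scaleC: "norm (c *\<^sub>C x) = cmod c * norm x"
proof -
  have "complex_of_real ((norm (c *\<^sub>C x))\<^sup>2) = complex_of_real ((cmod c * norm x)\<^sup>2)"
    unfolding cinner_self[symmetric] cinner_scaleC_left cinner_scaleC_right
    by (simp add: cinner_self power_mult_distrib complex_norm_square mult.assoc flip: of_real_power)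
  then show ?thesis
    by (simp only: of_real_eq_iff) (simp add: power2_eq_iff_nonneg)
qed

text \<open>Since Im <x, y> = Re <x, i y>, the real inner product determines the complex one, and
  facts about continuity and isometry carry over from the former.\<close>

lemma cinner_conv_inner: "cinner x y = Complex (inner x y) (inner x (\<i> *\<^sub>C y))"
  by (simp add: complex_eq_iff inner_eq_Re_cinner cinner_scaleC_right)

lemma norm_cinner_le: "cmod (cinner x y) \<le> norm x * norm y"
proof (cases "cinner x y = 0")
  case False
  \<comment> \<open>The unimodular \<open>c\<close> rotates \<open>cinner x y\<close> onto the
    positive real axis, so that the real Cauchy-Schwarz inequality suffices.\<close>
  define c where "c = cnj (cinner x y) / complex_of_real (cmod (cinner x y))"
  have "cnj (cinner x y) * cinner x y = (complex_of_real (cmod (cinner x y)))\<^sup>2"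
    by (simp only: mult.commute complex_norm_square[symmetric] of_real_power)
  then have c: "cmod c = 1" "c * cinner x y = complex_of_real (cmod (cinner x y))"
    using False by (simp_all add: c_def norm_divide power2_eq_square)
  have "cmod (cinner x y) = inner (c *\<^sub>C x) y"
    by (simp add: inner_eq_Re_cinner cinner_scaleC_left c)
  also have "\<dots> \<le> norm (c *\<^sub>C x) * norm y"
    by (rule norm_cauchy_schwarz)
  finally show ?thesis
    by (simp add: norm_scaleC c)
qed simp

lemma continuous_on_cinner [continuous_intros]:
  "continuous_on S f \<Longrightarrow> continuous_on S (\<lambda>s. cinner (f s) y)"
  unfolding cinner_conv_inner complex_eq by (intro continuous_intros)

lemma tendsto_scaleC:
  assumes "(f \<longlongrightarrow> a) F"
  shows "((\<lambda>n. c *\<^sub>C f n) \<longlongrightarrow> c *\<^sub>C a) F"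
proof -
  have "c *\<^sub>C f n - c *\<^sub>C a = c *\<^sub>C (f n - a)" for n
    by (metis add_diff_cancel diff_add_cancel scaleC_add_right)
  moreover have "((\<lambda>n. cmod c * norm (f n - a)) \<longlongrightarrow> 0) F"
    using assms by (simp add: LIM_zero tendsto_norm_zero tendsto_mult_right_zero)
  ultimately have "((\<lambda>n. norm (c *\<^sub>C f n - c *\<^sub>C a)) \<longlongrightarrow> 0) F"
    by (simp add: norm_scaleC)
  then show ?thesis
    by (simp add: tendsto_norm_zero_iff LIM_zero_cancel)
qed

text \<open>Polarization recovers the real inner product from the norms; commuting with
  multiplication by i then gives the imaginary part.\<close>

lemma cinner_eq_of_norm_eq:
  fixes f :: "'a::complex_hilbert \<Rightarrow> 'b::complex_hilbert"
  assumes add: "\<And>x y. f (x + y) = f x + f y" and scale: "\<And>c x. f (c *\<^sub>C x) = c *\<^sub>C f x"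
    and nrm: "\<And>x. norm (f x) = norm x"
  shows "cinner (f x) (f y) = cinner x y"
proof -
  have inner: "inner (f x) (f y) = inner x y" for x y
    using nrm[of "x + y"] by (simp add: dot_norm add nrm)
  show ?thesis
    by (simp add: cinner_conv_inner inner flip: scale)
qed

text \<open>The bound is a closed condition in x, so it extends from \<open>D\<close> to the whole
  space, where it can be tested at x = z.\<close>

lemma norm_le_of_dense:
  assumes "dense D" and "C \<ge> 0"
    and bound: "\<And>x. x \<in> D \<Longrightarrow> cmod (cinner x z) \<le> C * norm x"
  shows "norm z \<le> C"
proof (cases "z = 0")
  case False
  have "closed {x. cmod (cinner x z) \<le> C * norm x}"
    by (intro closed_Collect_le continuous_intros)
  then have "closure D \<subseteq> {x. cmod (cinner x z) \<le> C * norm x}"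
    by (intro closure_minimal) (auto intro: bound)
  then have "cmod (cinner z z) \<le> C * norm z"
    using assms(1) by (auto simp: dense_def)
  then show ?thesis
    using False by (simp add: cinner_self norm_mult power2_eq_square)
qed (simp add: assms)

lemma dense_orthogonal_eq_zero:
  assumes "dense D" "\<And>x. x \<in> D \<Longrightarrow> cinner x z = 0"
  shows "z = 0"
  using norm_le_of_dense[of D 0 z] assms by simp

section \<open>Orthogonal projection onto closed subspaces\<close>

lemma closest_point_exists:
  fixes S :: "'a::{real_inner,complete_space} set"
  assumes S: "subspace S" "closed S"
  shows "\<exists>y\<in>S. \<forall>s\<in>S. norm (x - y) \<le> norm (x - s)"
proof -
  define d where "d = (INF s\<in>S. (norm (x - s))\<^sup>2)"
  have bdd: "bdd_below ((\<lambda>s. (norm (x - s))\<^sup>2) ` S)"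
    by (rule bdd_belowI[of _ 0]) auto
  have ne: "S \<noteq> {}"
    using subspace_0[OF S(1)] by auto
  have d_le: "d \<le> (norm (x - s))\<^sup>2" if "s \<in> S" for s
    unfolding d_def using that by (rule cINF_lower[OF bdd])
  have "\<exists>s\<in>S. (norm (x - s))\<^sup>2 < d + inverse (real (Suc n))" for n
    using cInf_lessD[of "(\<lambda>s. (norm (x - s))\<^sup>2) ` S" "d + inverse (real (Suc n))"] ne
    by (auto simp: d_def)
  then obtain s where s: "\<And>n. s n \<in> S" "\<And>n. (norm (x - s n))\<^sup>2 < d + inverse (real (Suc n))"
    by metis
  \<comment> \<open>The midpoint of two terms of the minimizing sequence lies in \<open>S\<close>,
    so its squared distance from \<open>x\<close> is at least \<open>d\<close>; the parallelogram
    law then forces the terms together.\<close>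
  have parallelogram: "(norm (s m - s n))\<^sup>2 \<le> 2 * inverse (real (Suc m)) + 2 * inverse (real (Suc n))" for m n
  proof -
    have "(1/2) *\<^sub>R (s m + s n) \<in> S"
      using s(1) S(1) by (simp add: subspace_add subspace_scale)
    then have "d \<le> (norm (x - (1/2) *\<^sub>R (s m + s n)))\<^sup>2"
      by (rule d_le)
    moreover have "(norm (s m - s n))\<^sup>2 =
      2 * (norm (x - s m))\<^sup>2 + 2 * (norm (x - s n))\<^sup>2 - 4 * (norm (x - (1/2) *\<^sub>R (s m + s n)))\<^sup>2"
      by (simp add: power2_norm_eq_inner inner_diff_left inner_diff_right inner_add_left
          inner_add_right inner_commute field_simps)
    ultimately show ?thesis
      using s(2)[of m] s(2)[of n] by linarith
  qed
  have "Cauchy s"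
  proof (rule metric_CauchyI)
    fix e :: real assume "e > 0"
    then obtain N where N: "inverse (real (Suc N)) < e\<^sup>2 / 4"
      using reals_Archimedean[of "e\<^sup>2 / 4"] by auto
    have "dist (s m) (s n) < e" if "m \<ge> N" "n \<ge> N" for m n
    proof -
      have "inverse (real (Suc m)) \<le> inverse (real (Suc N))" "inverse (real (Suc n)) \<le> inverse (real (Suc N))"
        using that by (auto intro!: le_imp_inverse_le)
      then have "(norm (s m - s n))\<^sup>2 < e\<^sup>2"
        using parallelogram[of m n] N by linarith
      then show ?thesis
        using \<open>e > 0\<close> by (simp add: dist_norm power_less_imp_less_base)
    qed
    then show "\<exists>N. \<forall>m\<ge>N. \<forall>n\<ge>N. dist (s m) (s n) < e"
      by blast
  qed
  then obtain y where y: "s \<longlonglongrightarrow> y"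
    using Cauchy_convergent convergent_def by blast
  have "y \<in> S"
    using closed_sequentially[OF S(2) s(1) y] .
  have "(norm (x - y))\<^sup>2 \<le> d + 0"
  proof (rule LIMSEQ_le)
    show "(\<lambda>n. (norm (x - s n))\<^sup>2) \<longlonglongrightarrow> (norm (x - y))\<^sup>2"
      by (intro tendsto_intros y)
    show "(\<lambda>n. d + inverse (real (Suc n))) \<longlonglongrightarrow> d + 0"
      by (intro tendsto_intros LIMSEQ_inverse_real_of_nat)
    show "\<exists>N. \<forall>n\<ge>N. (norm (x - s n))\<^sup>2 \<le> d + inverse (real (Suc n))"
      using s(2) less_imp_le by blast
  qed
  then have "norm (x - y) \<le> norm (x - t)" if "t \<in> S" for t
    using d_le[OF that] by (metis add.right_neutral norm_ge_zero order_trans power2_le_imp_le)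
  then show ?thesis
    using \<open>y \<in> S\<close> by blast
qed

text \<open>The real setting lets the projection act on graphs in a product type; complex
  orthogonality is recovered afterwards by multiplying with a suitable scalar.\<close>

lemma orthogonal_projection_exists:
  fixes S :: "'a::{real_inner,complete_space} set"
  assumes S: "subspace S" "closed S"
  obtains y where "y \<in> S" "\<And>s. s \<in> S \<Longrightarrow> inner s (x - y) = 0"
proof -
  obtain y where y: "y \<in> S" "\<And>s. s \<in> S \<Longrightarrow> norm (x - y) \<le> norm (x - s)"
    using closest_point_exists[OF S] by blast
  have "inner s (x - y) = 0" if "s \<in> S" for s
  proof (cases "s = 0")
    case False
    \<comment> \<open>This \<open>t\<close> minimizes the squared norm of x - y - t s, a quadratic
      polynomial in t.\<close>
    define t where "t = inner s (x - y) / inner s s"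
    have "y + t *\<^sub>R s \<in> S"
      using y(1) that S(1) by (simp add: subspace_add subspace_scale)
    then have "(norm (x - y))\<^sup>2 \<le> (norm (x - y - t *\<^sub>R s))\<^sup>2"
      using y(2)[of "y + t *\<^sub>R s"] by (simp add: diff_diff_add)
    also have "\<dots> = (norm (x - y))\<^sup>2 - 2 * t * inner s (x - y) + t * (t * inner s s)"
      by (simp add: power2_norm_eq_inner inner_diff_left inner_diff_right inner_commute algebra_simps)
    also have "\<dots> = (norm (x - y))\<^sup>2 - (inner s (x - y))\<^sup>2 / inner s s"
      using False by (simp add: t_def power2_eq_square)
    finally have "(inner s (x - y))\<^sup>2 / inner s s \<le> 0"
      by simp
    moreover have "inner s s > 0"
      using False by simp
    ultimately have "(inner s (x - y))\<^sup>2 \<le> 0"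
      by (simp add: divide_le_0_iff)
    then show ?thesis
      by simp
  qed simp
  then show thesis
    using y(1) that by blast
qed

lemma subspace_closure:
  fixes S :: "'a::real_normed_vector set"
  assumes "subspace S"
  shows "subspace (closure S)"
proof (rule subspaceI)
  show "0 \<in> closure S"
    using subspace_0[OF assms] closure_subset by blast
next
  fix x y assume "x \<in> closure S" "y \<in> closure S"
  then obtain f g where "\<And>n. f n \<in> S" "f \<longlonglongrightarrow> x" "\<And>n. g n \<in> S" "g \<longlonglongrightarrow> y"
    by (auto simp: closure_sequential)
  then have "(\<forall>n. f n + g n \<in> S) \<and> (\<lambda>n. f n + g n) \<longlonglongrightarrow> x + y"
    using assms by (auto intro: subspace_add tendsto_add)
  then show "x + y \<in> closure S"
    unfolding closure_sequential by (rule exI[of _ "\<lambda>n. f n + g n"])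
next
  fix c x assume "x \<in> closure S"
  then obtain f where "\<And>n. f n \<in> S" "f \<longlonglongrightarrow> x"
    by (auto simp: closure_sequential)
  then have "(\<forall>n. c *\<^sub>R f n \<in> S) \<and> (\<lambda>n. c *\<^sub>R f n) \<longlonglongrightarrow> c *\<^sub>R x"
    using assms by (auto intro: subspace_scale tendsto_scaleR)
  then show "c *\<^sub>R x \<in> closure S"
    unfolding closure_sequential by (rule exI[of _ "\<lambda>n. c *\<^sub>R f n"])
qed

lemma dense_if_orthogonal_eq_zero:
  fixes S :: "'a::{real_inner,complete_space} set"
  assumes "subspace S" and "\<And>x. (\<And>s. s \<in> S \<Longrightarrow> inner s x = 0) \<Longrightarrow> x = 0"
  shows "dense S"
proof -
  have "x \<in> closure S" for x
  proof -
    obtain y where y: "y \<in> closure S" "\<And>s. s \<in> closure S \<Longrightarrow> inner s (x - y) = 0"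
      using orthogonal_projection_exists[OF subspace_closure[OF assms(1)] closed_closure] by blast
    then have "x - y = 0"
      using closure_subset by (intro assms(2)) blast
    then show ?thesis
      using y(1) by simp
  qed
  then show ?thesis
    by (auto simp: dense_def)
qed

section \<open>Unbounded operators as graphs\<close>

lemma
  assumes "linear_operator T"
  shows linear_operator_unique: "(x, y) \<in> T \<Longrightarrow> (x, y') \<in> T \<Longrightarrow> y = y'"
    and linear_operator_zero: "(0, 0) \<in> T"
    and linear_operator_add: "(x, y) \<in> T \<Longrightarrow> (x', y') \<in> T \<Longrightarrow> (x + x', y + y') \<in> T"
    and linear_operator_scaleC: "(x, y) \<in> T \<Longrightarrow> (c *\<^sub>C x, c *\<^sub>C y) \<in> T"
  using assms by (auto simp: linear_operator_def single_valued_def)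

lemma linear_operator_diff:
  "linear_operator T \<Longrightarrow> (x, y) \<in> T \<Longrightarrow> (x', y') \<in> T \<Longrightarrow> (x - x', y - y') \<in> T"
  using linear_operator_add[of T x y "- x'" "- y'"] linear_operator_scaleC[of T x' y' "-1"]
  by (simp add: scaleC_minus_one)

lemma subspace_linear_operator: "linear_operator T \<Longrightarrow> subspace T"
  by (auto simp: subspace_def zero_prod_def scaleR_scaleC
      intro: linear_operator_zero linear_operator_add linear_operator_scaleC)

lemma linear_operator_converse:
  "linear_operator T \<Longrightarrow> single_valued (T\<inverse>) \<Longrightarrow> linear_operator (T\<inverse>)"
  unfolding linear_operator_def by simp

lemma linear_operator_relcomp:
  assumes "linear_operator S" "linear_operator T"
  shows "linear_operator (S O T)"
proof -
  have "single_valued (S O T)"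
    using assms by (auto simp: linear_operator_def intro: single_valued_relcomp)
  then show ?thesis
    unfolding linear_operator_def
    by (auto intro: linear_operator_add[OF assms(1)] linear_operator_add[OF assms(2)]
        linear_operator_scaleC[OF assms(1)] linear_operator_scaleC[OF assms(2)]
        linear_operator_zero[OF assms(1)] linear_operator_zero[OF assms(2)] relcompI)
qed

lemma adjoint_operator_iff:
  "(y, z) \<in> adjoint_operator T \<longleftrightarrow> (\<forall>x w. (x, w) \<in> T \<longrightarrow> cinner w y = cinner x z)"
  by (auto simp: adjoint_operator_def)

lemma adjoint_operatorD:
  "(y, z) \<in> adjoint_operator T \<Longrightarrow> (x, w) \<in> T \<Longrightarrow> cinner w y = cinner x z"
  by (simp add: adjoint_operator_iff)

lemma linear_operator_adjoint:
  assumes "dense (Domain T)"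
  shows "linear_operator (adjoint_operator T)"
proof -
  have "z = z'" if "(y, z) \<in> adjoint_operator T" "(y, z') \<in> adjoint_operator T" for y z z'
  proof -
    have "cinner x (z - z') = 0" if "x \<in> Domain T" for x
      using that adjoint_operatorD[OF \<open>(y, z) \<in> _\<close>] adjoint_operatorD[OF \<open>(y, z') \<in> _\<close>]
      by (auto simp: cinner_diff_right Domain_iff)
    then show ?thesis
      using dense_orthogonal_eq_zero[OF assms] by fastforce
  qed
  then show ?thesis
    by (auto simp: linear_operator_def single_valued_def adjoint_operator_iff cinner_add_right
        cinner_scaleC_right)
qed

lemma dense_Domain_if_orthogonal_eq_zero:
  assumes T: "linear_operator T"
    and orth: "\<And>z. (\<And>x y. (x, y) \<in> T \<Longrightarrow> cinner x z = 0) \<Longrightarrow> z = 0"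
  shows "dense (Domain T)"
proof (rule dense_if_orthogonal_eq_zero)
  have "Domain T = fst ` T"
    by force
  then show "subspace (Domain T)"
    using linear_subspace_image[OF linear_fst subspace_linear_operator[OF T]] by simp
next
  fix z assume z: "\<And>x. x \<in> Domain T \<Longrightarrow> inner x z = 0"
  show "z = 0"
  proof (rule orth)
    fix x y assume "(x, y) \<in> T"
    \<comment> \<open>Scaling by the conjugate of \<open>cinner x z\<close> turns a vanishing real
      part into |<x, z>|^2 = 0.\<close>
    then have "inner (cnj (cinner x z) *\<^sub>C x) z = 0"
      by (intro z DomainI[OF linear_operator_scaleC[OF T]])
    then show "cinner x z = 0"
      by (simp add: inner_eq_Re_cinner cinner_scaleC_left complex_eq_iff sum_squares_eq_zero_iff)
  qed
qed

text \<open>The orthogonal complement of the graph consists of the pairs \<open>(- z, y)\<close> with \<open>(y, z)\<close> in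
  the adjoint.\<close>

lemma graph_decomposition:
  assumes T: "linear_operator T"
  obtains x w y z where "(x, w) \<in> closure T" "(y, z) \<in> adjoint_operator T"
    "a = x - z" "b = w + y"
proof -
  obtain x w where xw: "(x, w) \<in> closure T"
    and orth: "\<And>s. s \<in> closure T \<Longrightarrow> inner s ((a, b) - (x, w)) = 0"
    using orthogonal_projection_exists[OF subspace_closure[OF subspace_linear_operator[OF T]] closed_closure, of "(a, b)"]
    by (metis surj_pair)
  have "(b - w, x - a) \<in> adjoint_operator T"
    unfolding adjoint_operator_iff
  proof (intro allI impI)
    fix p q assume "(p, q) \<in> T"
    \<comment> \<open>\<open>e\<close> is the complex pairing of \<open>(p, q)\<close> with the
      residual \<open>(a - x, b - w)\<close>. The pair scaled by \<open>cnj e\<close> is again in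
      the graph, and its real pairing with the residual is |e|^2.\<close>
    define e where "e = cinner q (b - w) + cinner p (a - x)"
    have "(cnj e *\<^sub>C p, cnj e *\<^sub>C q) \<in> closure T"
      using linear_operator_scaleC[OF T \<open>(p, q) \<in> T\<close>] closure_subset by blast
    from orth[OF this] have "Re (cnj e * e) = 0"
      by (simp add: e_def inner_eq_Re_cinner cinner_scaleC_left algebra_simps)
    then have "e = 0"
      by (simp add: complex_eq_iff sum_squares_eq_zero_iff)
    then show "cinner q (b - w) = cinner p (x - a)"
      by (simp add: e_def cinner_diff_right algebra_simps)
  qed
  then show thesis
    using that[OF xw] by simp
qed

section \<open>Boundedness and Riesz representation\<close>

lemma linear_operator_continuous_iff_bounded:
  assumes T: "linear_operator T"
  shows "continuous_operator T \<longleftrightarrow> (\<exists>C\<ge>0. \<forall>(x, y)\<in>T. norm y \<le> C * norm x)"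
proof -
  have app: "apply_operator T x = y" if "(x, y) \<in> T" for x y
    unfolding apply_operator_def using that linear_operator_unique[OF T] by blast
  show ?thesis
  proof
    assume "continuous_operator T"
    then obtain d where d: "d > 0"
      and le: "\<And>x. x \<in> Domain T \<Longrightarrow> dist x 0 < d \<Longrightarrow> dist (apply_operator T x) (apply_operator T 0) < 1"
      unfolding continuous_operator_def continuous_on_iff
      using linear_operator_zero[OF T] by (metis DomainI zero_less_one)
    have "norm y \<le> 2 / d * norm x" if "(x, y) \<in> T" for x y
    proof (cases "x = 0")
      case True
      then show ?thesis
        using linear_operator_unique[OF T that] linear_operator_zero[OF T] by simp
    next
      case False
      \<comment> \<open>The scaled vector has norm d / 2, inside the ball on which continuity at 0
        bounds the image by 1.\<close>
      define r where "r = d / (2 * norm x)"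
      have r: "r > 0" "r * norm x < d"
        using False d by (simp_all add: r_def)
      have rT: "(r *\<^sub>R x, r *\<^sub>R y) \<in> T"
        using linear_operator_scaleC[OF T that] by (simp add: scaleR_scaleC)
      have "norm (r *\<^sub>R y) < 1"
        using le[of "r *\<^sub>R x"] rT app[OF rT] app[OF linear_operator_zero[OF T]] r by auto
      then show ?thesis
        using False d by (simp add: r_def field_simps)
    qed
    then show "\<exists>C\<ge>0. \<forall>(x, y)\<in>T. norm y \<le> C * norm x"
      using d by (intro exI[of _ "2 / d"]) auto
  next
    assume "\<exists>C\<ge>0. \<forall>(x, y)\<in>T. norm y \<le> C * norm x"
    then obtain C where "C \<ge> 0" and C: "\<And>x y. (x, y) \<in> T \<Longrightarrow> norm y \<le> C * norm x"
      by auto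
    have "C-lipschitz_on (Domain T) (apply_operator T)"
    proof (rule lipschitz_onI)
      fix x x' assume "x \<in> Domain T" "x' \<in> Domain T"
      then show "dist (apply_operator T x) (apply_operator T x') \<le> C * dist x x'"
        by (auto simp: app dist_norm intro!: C linear_operator_diff[OF T])
    qed fact
    then show "continuous_operator T"
      unfolding continuous_operator_def by (rule lipschitz_on_continuous_on)
  qed
qed

text \<open>Closability of the functional replaces its boundedness.  The projection of \<open>(0, 1)\<close> along
  the closure of the graph gives a nonzero \<open>y\<close> in the domain of the adjoint, which is
  rescaled to \<open>1\<close>.\<close>

lemma riesz_representation:
  fixes F :: "('a::complex_hilbert \<times> complex) set"
  assumes F: "linear_operator F" and "dense (Domain F)" and "(0, 1) \<notin> closure F"
  obtains z where "\<And>x w. (x, w) \<in> F \<Longrightarrow> w = cinner x z"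
proof -
  obtain x w y z where xw: "(x, w) \<in> closure F" and yz: "(y, z) \<in> adjoint_operator F"
    and eq: "0 = x - z" "1 = w + y"
    by (rule graph_decomposition[OF F])
  note lin = linear_operator_adjoint[OF assms(2)]
  \<comment> \<open>If \<open>y\<close> were 0, then \<open>z = 0\<close>, hence
    \<open>x = 0\<close> and \<open>w = 1\<close>, against the assumption on
    \<open>(0, 1)\<close>.\<close>
  have "y \<noteq> 0"
    using xw yz eq linear_operator_unique[OF lin linear_operator_zero[OF lin]] assms(3) by force
  then have "(1, inverse y *\<^sub>C z) \<in> adjoint_operator F"
    using linear_operator_scaleC[OF lin yz, of "inverse y"] by (simp add: scaleC_complex_def)
  then show thesis
    by (intro that) (auto simp: cinner_complex_def dest: adjoint_operatorD)
qed

section \<open>Selfadjointness of the kernel operator\<close>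

text \<open>Surjectivity of 1 + A leaves no room for a larger adjoint: a pair in the adjoint and a
  pair in A with the same sum differ by some (d, -d), and d is orthogonal to the range of 1 +
  A.\<close>

lemma selfadjointI:
  assumes A: "linear_operator A" and pos: "positive_operator A"
    and symmetric: "A \<subseteq> adjoint_operator A"
    and onto: "\<And>h. \<exists>y w. (y, w) \<in> A \<and> h = y + w"
  shows "selfadjoint A"
proof -
  have dense: "dense (Domain A)"
  proof (rule dense_Domain_if_orthogonal_eq_zero[OF A])
    \<comment> \<open>Density of the domain is derived, not assumed: pairing h = y + A y with y
      leaves |y|^2 + <y, A y> = 0, and both terms are nonnegative.\<close>
    fix h assume h: "\<And>x y. (x, y) \<in> A \<Longrightarrow> cinner x h = 0"
    obtain y w where yw: "(y, w) \<in> A" "h = y + w"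
      using onto by blast
    then have "Re (cinner y y + cinner y w) = 0"
      using h[OF yw(1)] by (simp add: cinner_add_right)
    moreover have "Re (cinner y w) \<ge> 0"
      using pos yw(1) adjoint_operatorD[OF subsetD[OF symmetric yw(1)] yw(1)]
      by (auto simp: positive_operator_def complex_nonneg_Reals_iff)
    moreover have "Re (cinner y y) = (norm y)\<^sup>2"
      by (simp add: cinner_self)
    ultimately have "(norm y)\<^sup>2 \<le> 0"
      unfolding plus_complex.simps by linarith
    then have "y = 0"
      by simp
    then show "h = 0"
      using yw linear_operator_unique[OF A _ linear_operator_zero[OF A]] by auto
  qed
  have adj: "linear_operator (adjoint_operator A)"
    by (rule linear_operator_adjoint[OF dense])
  have "adjoint_operator A \<subseteq> A"
  proof safe
    fix y z assume yz: "(y, z) \<in> adjoint_operator A"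
    obtain u v where uv: "(u, v) \<in> A" "y + z = u + v"
      using onto by blast
    have d: "(y - u, z - v) \<in> adjoint_operator A"
      using linear_operator_diff[OF adj yz] uv(1) symmetric by blast
    obtain x w where xw: "(x, w) \<in> A" "y - u = x + w"
      using onto by blast
    \<comment> \<open>With d = y - u, the adjoint relation on \<open>(x, w)\<close> reads <w, d> =
      -<x, d>; since d = x + w, this gives <d, d> = 0.\<close>
    have "z - v = - (y - u)"
      using uv(2) by (simp add: algebra_simps)
    then have "cinner w (y - u) = - cinner x (y - u)"
      using adjoint_operatorD[OF d xw(1)] by (simp only: cinner_minus_right)
    then have "cinner (x + w) (y - u) = 0"
      by (simp only: cinner_add_left add.right_inverse)
    then have "y = u" "z = v"
      using xw(2) uv(2) by auto
    then show "(y, z) \<in> A"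
      using uv(1) by simp
  qed
  then show ?thesis
    unfolding selfadjoint_def using A dense symmetric by blast
qed

lemma
  assumes T: "linear_operator T" "dense (Domain T)"
  shows linear_operator_kernel_operator: "linear_operator (kernel_operator T)"
    and positive_kernel_operator: "positive_operator (kernel_operator T)"
    and symmetric_kernel_operator: "kernel_operator T \<subseteq> adjoint_operator (kernel_operator T)"
proof -
  show "linear_operator (kernel_operator T)"
    unfolding kernel_operator_def using linear_operator_adjoint[OF T(2)] T(1)
    by (rule linear_operator_relcomp)
  \<comment> \<open>When \<open>z\<close> is the adjoint image of some y, this says <A y, y'> = <T^*
    y, T^* y'>, which yields both positivity and symmetry.\<close>
  have cinner: "cinner w y' = cinner z z'"
    if "(z, w) \<in> T" "(y', z') \<in> adjoint_operator T" for w y' z z'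
    using that by (simp add: adjoint_operatorD)
  show "positive_operator (kernel_operator T)"
    by (auto simp: positive_operator_def kernel_operator_def cinner cinner_self)
  show "kernel_operator T \<subseteq> adjoint_operator (kernel_operator T)"
    by (auto simp: kernel_operator_def adjoint_operator_iff[of _ _ "_ O _"] cinner)
      (metis cinner cinner_commute)
qed

text \<open>The intermediate vector \<open>z\<close> stays in the conclusion: selfadjointness needs
  only \<open>(y, w)\<close>, but the density argument in H_+ works with \<open>z\<close>
  itself.\<close>

lemma kernel_operator_onto:
  assumes "linear_operator T" "closed T"
  obtains y z w where "(y, z) \<in> adjoint_operator T" "(z, w) \<in> T" "h = y + w"
  using graph_decomposition[OF assms(1), of 0 h] assms(2)
  by (metis add.commute closure_closed eq_iff_diff_eq_0)

lemma selfadjoint_kernel_operator: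
  assumes "linear_operator T" "dense (Domain T)" "closed T"
  shows "selfadjoint (kernel_operator T)"
proof (rule selfadjointI)
  show "\<exists>y w. (y, w) \<in> kernel_operator T \<and> h = y + w" for h
    using kernel_operator_onto[OF assms(1,3), of h] unfolding kernel_operator_def by blast
qed (use assms in \<open>simp_all add: linear_operator_kernel_operator positive_kernel_operator
      symmetric_kernel_operator\<close>)

section \<open>The inverse of the kernel operator\<close>

lemma single_valued_converse_adjoint:
  assumes T: "linear_operator T" "dense (Domain T)" and "dense (Range T)"
  shows "single_valued ((adjoint_operator T)\<inverse>)"
proof (rule single_valuedI)
  fix z y y' assume "(z, y) \<in> (adjoint_operator T)\<inverse>" "(z, y') \<in> (adjoint_operator T)\<inverse>"
  then have "(y - y', 0) \<in> adjoint_operator T"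
    using linear_operator_diff[OF linear_operator_adjoint[OF T(2)], of y z y' z] by simp
  then have "cinner w (y - y') = 0" if "w \<in> Range T" for w
    using that adjoint_operatorD by fastforce
  then show "y = y'"
    using dense_orthogonal_eq_zero[OF assms(3)] by fastforce
qed

lemma single_valued_converse_kernel_operator:
  assumes "linear_operator T" "dense (Domain T)" "single_valued (T\<inverse>)" "dense (Range T)"
  shows "single_valued ((kernel_operator T)\<inverse>)"
  using single_valued_relcomp[OF assms(3) single_valued_converse_adjoint[OF assms(1,2,4)]]
  by (simp add: kernel_operator_def converse_relcomp)

lemma
  assumes T: "linear_operator T" "dense (Domain T)" "single_valued (T\<inverse>)" "dense (Range T)"
  shows linear_operator_hamiltonian: "linear_operator (hamiltonian T)"
    and positive_hamiltonian: "positive_operator (hamiltonian T)"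
    and symmetric_hamiltonian: "hamiltonian T \<subseteq> adjoint_operator (hamiltonian T)"
proof -
  let ?A = "kernel_operator T"
  show "linear_operator (hamiltonian T)"
    unfolding hamiltonian_def using linear_operator_kernel_operator[OF T(1,2)]
      single_valued_converse_kernel_operator[OF T] by (rule linear_operator_converse)
  have sym: "cinner y x' = cinner x y'" if "(x, y) \<in> ?A" "(x', y') \<in> ?A" for x y x' y'
    using that symmetric_kernel_operator[OF T(1,2)] adjoint_operatorD by fast
  show "hamiltonian T \<subseteq> adjoint_operator (hamiltonian T)"
    by (auto simp: hamiltonian_def adjoint_operator_iff sym)
  show "positive_operator (hamiltonian T)"
    using positive_kernel_operator[OF T(1,2)]
    by (auto simp: positive_operator_def hamiltonian_def) (metis case_prodD sym)
qed

lemma selfadjoint_hamiltonian: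
  assumes "linear_operator T" "dense (Domain T)" "closed T" "single_valued (T\<inverse>)" "dense (Range T)"
  shows "selfadjoint (hamiltonian T)"
proof (rule selfadjointI)
  show "\<exists>y w. (y, w) \<in> hamiltonian T \<and> h = y + w" for h
    using kernel_operator_onto[OF assms(1,3), of h]
    unfolding kernel_operator_def hamiltonian_def by (metis add.commute converseI relcompI)
qed (use assms in \<open>simp_all add: linear_operator_hamiltonian positive_hamiltonian
      symmetric_hamiltonian\<close>)

lemma zero_not_eigenvalue:
  assumes "linear_operator T" "single_valued (T\<inverse>)"
  shows "\<not> eigenvalue T 0"
  using assms linear_operator_zero[OF assms(1)]
  by (auto simp: eigenvalue_def single_valued_def)

section \<open>Unitary extensions\<close>

lemma unitary_norm: "unitary U \<Longrightarrow> norm (U x) = norm x"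
  by (simp add: unitary_def norm_eq_sqrt_inner inner_eq_Re_cinner)

lemma unitary_diff: "unitary U \<Longrightarrow> U (x - y) = U x - U y"
  unfolding unitary_def by (metis add_diff_cancel_right' diff_add_cancel)

lemma continuous_on_unitary:
  assumes "unitary U"
  shows "continuous_on S U"
proof (rule lipschitz_on_continuous_on)
  show "1-lipschitz_on S U"
    by (rule lipschitz_onI) (simp_all add: dist_norm unitary_norm[OF assms] flip: unitary_diff[OF assms])
qed

lemma bij_unitary:
  assumes U: "unitary U"
  shows "bij U"
proof -
  have "x = y" if "U x = U y" for x y
    using unitary_norm[OF U, of "x - y"] that by (simp add: unitary_diff[OF U])
  then show ?thesis
    using U by (auto simp: bij_def inj_def unitary_def)
qed

lemma unitary_inv:
  assumes "unitary U"
  shows "unitary (inv U)"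
proof -
  have U: "U (inv U x) = x" for x
    using bij_unitary[OF assms] by (simp add: bij_is_surj surj_f_inv_f)
  have inv: "inv U y = x" if "U x = y" for x y
    using that bij_unitary[OF assms] by (auto simp: bij_is_inj)
  have "inv U (x + y) = inv U x + inv U y" for x y
    using assms by (intro inv) (simp add: unitary_def U)
  moreover have "inv U (c *\<^sub>C x) = c *\<^sub>C inv U x" for c x
    using assms by (intro inv) (simp add: unitary_def U)
  moreover have "cinner (inv U x) (inv U y) = cinner x y" for x y
  proof -
    have "cinner (U (inv U x)) (U (inv U y)) = cinner (inv U x) (inv U y)"
      using assms by (simp add: unitary_def)
    then show ?thesis
      by (simp add: U)
  qed
  moreover have "surj (inv U)"
    using bij_unitary[OF assms] by (simp add: bij_is_surj bij_imp_bij_inv)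
  ultimately show ?thesis
    by (simp add: unitary_def)
qed

lemma extends_to_unitary_converse:
  assumes "extends_to_unitary T U"
  shows "extends_to_unitary (T\<inverse>) (inv U)"
  using assms unitary_inv bij_unitary
  unfolding extends_to_unitary_def graph_of_def by (fastforce simp: bij_is_inj)

lemma unitary_extension_unique:
  assumes "extends_to_unitary T U" "extends_to_unitary T U'" and "dense (Domain T)"
  shows "U = U'"
proof -
  have "closed {x. U x = U' x}"
    using assms by (intro closed_Collect_eq continuous_on_unitary) (simp_all add: extends_to_unitary_def)
  then have "closure (Domain T) \<subseteq> {x. U x = U' x}"
    using assms by (intro closure_minimal) (auto simp: extends_to_unitary_def graph_of_def)
  then show ?thesis
    using assms(3) by (auto simp: dense_def)
qed

text \<open>For the kernel operator from H_- to H_+ it is the range whose density is shown directly;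
  the continuous surjection \<open>inv U\<close> carries this over to the domain.\<close>

lemma dense_Domain_if_dense_Range:
  assumes "extends_to_unitary T U" "dense (Range T)"
  shows "dense (Domain T)"
proof -
  have inv: "unitary (inv U)" "Domain T = inv U ` Range T"
    using extends_to_unitary_converse[OF assms(1)]
    by (force simp: extends_to_unitary_def graph_of_def image_iff)+
  have "inv U ` closure (Range T) \<subseteq> closure (inv U ` Range T)"
    by (rule continuous_image_closure_subset[OF continuous_on_unitary[OF inv(1)] subset_UNIV])
  then show ?thesis
    using inv assms(2) by (auto simp: dense_def unitary_def)
qed

text \<open>Extension by continuity in terms of graphs: the images of a convergent sequence are
  Cauchy because distances are preserved. Applied to a graph it gives totality of the closure,
  applied to the converse it gives surjectivity.\<close>

lemma isometric_closure_total:
  fixes T :: "('a::metric_space \<times> 'b::complete_space) set"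
  assumes iso: "\<And>x y x' y'. (x, y) \<in> T \<Longrightarrow> (x', y') \<in> T \<Longrightarrow> dist y y' = dist x x'"
    and "closure (Domain T) = UNIV"
  shows "\<exists>y. (x, y) \<in> closure T"
proof -
  have "x \<in> closure (Domain T)"
    using assms(2) by simp
  then obtain f where f: "\<And>n. f n \<in> Domain T" "f \<longlonglongrightarrow> x"
    unfolding closure_sequential by blast
  then have "\<exists>y. (f n, y) \<in> T" for n
    by blast
  then obtain g where g: "\<And>n. (f n, g n) \<in> T"
    by metis
  have "Cauchy g"
    using LIMSEQ_imp_Cauchy[OF f(2)] unfolding Cauchy_def by (simp add: iso[OF g g])
  then obtain y where y: "g \<longlonglongrightarrow> y"
    using Cauchy_convergent convergent_def by blast
  have "(\<lambda>n. (f n, g n)) \<longlonglongrightarrow> (x, y)"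
    by (intro tendsto_Pair f y)
  then have "(x, y) \<in> closure T"
    using g unfolding closure_sequential by (intro exI[of _ "\<lambda>n. (f n, g n)"]) blast
  then show ?thesis ..
qed

text \<open>The closure of the graph of \<open>T\<close> is itself the graph of the extension.
  Preservation of norms passes to the closure and makes it single-valued; completeness makes it
  total and onto.\<close>

lemma unitary_extension_exists:
  fixes T :: "('a::complex_hilbert \<times> 'b::complex_hilbert) set"
  assumes T: "linear_operator T" and dense: "dense (Domain T)" "dense (Range T)"
    and iso: "\<And>x y. (x, y) \<in> T \<Longrightarrow> norm y = norm x"
  shows "\<exists>U. extends_to_unitary T U"
proof -
  have dist: "dist y y' = dist x x'" if "(x, y) \<in> T" "(x', y') \<in> T" for x y x' y'
    using iso[OF linear_operator_diff[OF T that]] by (simp add: dist_norm)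
  have total: "\<exists>y. (x, y) \<in> closure T" for x
    using dist dense(1) unfolding dense_def by (rule isometric_closure_total)
  have onto: "\<exists>x. (x, y) \<in> closure T" for y
  proof -
    have "\<exists>x. (y, x) \<in> closure (T\<inverse>)"
    proof (rule isometric_closure_total)
      show "closure (Domain (T\<inverse>)) = UNIV"
        using dense(2) by (simp add: dense_def)
    qed (auto simp: dist)
    moreover have "prod.swap ` closure (T\<inverse>) \<subseteq> closure T"
      using closure_subset[of T] by (intro image_closure_subset continuous_on_swap) auto
    ultimately show ?thesis
      by force
  qed
  have "closed {p::'a \<times> 'b. norm (snd p) = norm (fst p)}"
    by (intro closed_Collect_eq continuous_intros)
  then have "closure T \<subseteq> {p. norm (snd p) = norm (fst p)}"
    by (intro closure_minimal) (auto simp: iso)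
  then have norm_eq: "norm y = norm x" if "(x, y) \<in> closure T" for x y
    using that by auto
  have sub: "subspace (closure T)"
    by (intro subspace_closure subspace_linear_operator T)
  have scale: "(c *\<^sub>C x, c *\<^sub>C y) \<in> closure T" if xy: "(x, y) \<in> closure T" for c x y
  proof -
    obtain f where f: "\<And>n. f n \<in> T" "f \<longlonglongrightarrow> (x, y)"
      using xy unfolding closure_sequential by blast
    have "(\<lambda>n. (c *\<^sub>C fst (f n), c *\<^sub>C snd (f n))) \<longlonglongrightarrow> (c *\<^sub>C x, c *\<^sub>C y)"
      using tendsto_fst[OF f(2)] tendsto_snd[OF f(2)]
      by (intro tendsto_Pair tendsto_scaleC) simp_all
    moreover have "(c *\<^sub>C fst (f n), c *\<^sub>C snd (f n)) \<in> T" for n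
      using f(1) by (intro linear_operator_scaleC[OF T]) simp
    ultimately show ?thesis
      unfolding closure_sequential by (intro exI[of _ "\<lambda>n. (c *\<^sub>C fst (f n), c *\<^sub>C snd (f n))"]) blast
  qed
  have unique: "y = y'" if "(x, y) \<in> closure T" "(x, y') \<in> closure T" for x y y'
    using norm_eq[of 0 "y - y'"] subspace_diff[OF sub that] by simp
  obtain U where U: "\<And>x. (x, U x) \<in> closure T"
    using total by metis
  have add: "U (x + y) = U x + U y" for x y
    using unique[OF U[of "x + y"]] subspace_add[OF sub U[of x] U[of y]] by simp
  have scaleC: "U (c *\<^sub>C x) = c *\<^sub>C U x" for c x
    by (rule unique[OF U scale[OF U]])
  have "surj U"
    using onto unique U by (metis surjI)
  then have "unitary U"
    using add scaleC cinner_eq_of_norm_eq[OF add scaleC norm_eq[OF U]] by (simp add: unitary_def)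
  moreover have "T \<subseteq> graph_of U"
    using closure_subset unique[OF U] by (fastforce simp: graph_of_def)
  ultimately show ?thesis
    by (auto simp: extends_to_unitary_def)
qed

section \<open>The conjugate dual\<close>

lemma unitary_onto_conjugate_dual_cinner:
  fixes U :: "'m::complex_hilbert \<Rightarrow> 'p::complex_hilbert"
  assumes U: "unitary U"
  shows "unitary_onto_conjugate_dual (\<lambda>y x. cinner (U y) x)"
proof -
  have onorm: "onorm (cinner z) = norm z" for z :: 'p
  proof (cases "z = 0")
    case True
    then show ?thesis
      by (simp add: onorm_zero cinner_zero_left[abs_def])
  next
    case False
    have "onorm (cinner z) \<le> norm z"
      by (rule onorm_bound) (simp_all add: norm_cinner_le)
    \<comment> \<open>The supremum defining \<open>onorm\<close> is attained at z.\<close>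
    moreover have "norm (cinner z z) / norm z \<le> onorm (cinner z)"
      unfolding onorm_def using norm_cinner_le[of z]
      by (intro cSUP_upper bdd_aboveI[of _ "norm z"]) (auto simp: divide_le_eq)
    ultimately show ?thesis
      using False by (simp add: cinner_self norm_mult power2_eq_square)
  qed
  have "inj (\<lambda>y x. cinner (U y) x)"
  proof (rule injI)
    fix y z assume "cinner (U y) = cinner (U z)"
    then have "cinner (U y - U z) (U y - U z) = 0"
      by (simp add: cinner_diff_left)
    then show "y = z"
      using bij_unitary[OF U] by (simp add: bij_is_inj inj_eq)
  qed
  moreover have "cinner (U y) \<in> conjugate_dual" for y
  proof -
    have "continuous_on UNIV (\<lambda>x. cnj (cinner x (U y)))"
      by (intro continuous_intros)
    then show ?thesis
      by (simp add: conjugate_dual_def cinner_add_right cinner_scaleC_right flip: cinner_commute)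
  qed
  moreover have "\<exists>y. f = cinner (U y)" if f: "f \<in> conjugate_dual" for f
  proof -
    \<comment> \<open>Conjugation makes the conjugate-linear \<open>f\<close> linear. Continuity of
      \<open>f\<close> closes the graph \<open>F\<close>, so the condition on \<open>(0, 1)\<close>
      reduces to \<open>f 0 = 0\<close>.\<close>
    define F where "F = {(x, w). w = cnj (f x)}"
    have f_simps: "f (x + y) = f x + f y" "f (c *\<^sub>C x) = cnj c * f x" for x y c
      using f by (simp_all add: conjugate_dual_def)
    then have "f 0 = 0"
      by (metis add_cancel_right_left)
    then have "linear_operator F"
      by (simp add: linear_operator_def single_valued_def F_def f_simps scaleC_complex_def)
    moreover have "dense (Domain F)"
      by (simp add: F_def Domain_unfold dense_def)
    moreover have "continuous_on UNIV (f \<circ> fst :: 'p \<times> complex \<Rightarrow> complex)"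
      using f by (intro continuous_on_compose continuous_on_fst continuous_on_id)
        (auto simp: conjugate_dual_def intro: continuous_on_subset)
    then have "closed {p. snd p = cnj ((f \<circ> fst) p)}"
      by (intro closed_Collect_eq continuous_on_snd continuous_on_id continuous_on_cnj)
    then have "closure F = F"
      by (intro closure_closed) (simp add: F_def case_prod_unfold)
    then have "(0, 1) \<notin> closure F"
      using \<open>f 0 = 0\<close> by (simp add: F_def)
    ultimately obtain z where "\<And>x w. (x, w) \<in> F \<Longrightarrow> w = cinner x z"
      using riesz_representation by blast
    then have "cnj (f x) = cinner x z" for x
      by (simp add: F_def)
    then have "f = cinner z"
      by (metis (no_types) cinner_commute complex_cnj_cnj ext)
    moreover obtain y where "z = U y"
      using U by (metis unitary_def surjD)
    ultimately show ?thesis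
      by blast
  qed
  ultimately have "bij_betw (\<lambda>y x. cinner (U y) x) UNIV conjugate_dual"
    unfolding bij_betw_def by (auto simp: image_iff)
  then show ?thesis
    using U onorm unitary_norm[OF U]
    by (simp add: unitary_onto_conjugate_dual_def unitary_def cinner_add_left cinner_scaleC_left
        fun_eq_iff)
qed

section \<open>Triplets\<close>

context
  fixes jp :: "('p::complex_hilbert \<times> 'o::complex_hilbert) set"
    and jm :: "('o \<times> 'm::complex_hilbert) set"
  assumes triplet: "closely_embedded_triplet jp jm"
begin

lemma
  shows jp_embedding: "linear_operator jp" "dense (Domain jp)" "closed jp" "single_valued (jp\<inverse>)" "dense (Range jp)"
    and jm_embedding: "linear_operator jm" "dense (Domain jm)" "single_valued (jm\<inverse>)" "dense (Range jm)"
    and Domain_adjoint_subset: "Domain (adjoint_operator jp) \<subseteq> Domain jm"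
  using triplet by (auto simp: closely_embedded_triplet_def closed_embedding_def)

section \<open>Consequences of condition (th3)\<close>

lemma cmod_cinner_le:
  assumes "(y, v) \<in> jm" "(x, x') \<in> jp"
  shows "cmod (cinner x' y) \<le> norm v * norm x"
proof (cases "x = 0")
  case True
  then have "x' = 0"
    using assms(2) linear_operator_unique[OF jp_embedding(1) _ linear_operator_zero[OF jp_embedding(1)]] by simp
  then show ?thesis
    by simp
next
  case False
  have "ennreal (cmod (cinner x' y) / norm x) \<le>
      (SUP (x, x') \<in> {(x, x'). (x, x') \<in> jp \<and> x \<noteq> 0}. ennreal (cmod (cinner x' y) / norm x))"
    using assms(2) False by (intro SUP_upper2[of "(x, x')"]) auto
  also have "\<dots> = ennreal (norm v)"
    using triplet assms(1) by (auto simp: closely_embedded_triplet_def)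
  finally show ?thesis
    using False by (simp add: divide_le_eq)
qed

text \<open>Together with \<open>cmod_cinner_le\<close> this is (th3) with the quotients cleared:
  \<open>norm v\<close> is an upper bound, and the least one.\<close>

lemma norm_jm_le:
  assumes "(y, v) \<in> jm" "C \<ge> 0"
    and "\<And>x x'. (x, x') \<in> jp \<Longrightarrow> cmod (cinner x' y) \<le> C * norm x"
  shows "norm v \<le> C"
proof -
  have "ennreal (norm v) =
      (SUP (x, x') \<in> {(x, x'). (x, x') \<in> jp \<and> x \<noteq> 0}. ennreal (cmod (cinner x' y) / norm x))"
    using triplet assms(1) by (auto simp: closely_embedded_triplet_def)
  also have "\<dots> \<le> ennreal C"
    using assms(2,3) by (intro SUP_least) (auto simp: divide_le_eq)
  finally show ?thesis
    using assms(2) by simp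
qed

lemma Domain_adjoint_eq: "Domain (adjoint_operator jp) = Domain jm"
proof (intro equalityI Domain_adjoint_subset subsetI)
  fix y assume "y \<in> Domain jm"
  then obtain v where v: "(y, v) \<in> jm"
    by blast
  \<comment> \<open>\<open>F\<close> is the graph of the functional that sends x to <x, y> through
    \<open>jp\<close>; by (th3) it is bounded by \<open>norm v\<close>.\<close>
  define F where "F = jp O graph_of (\<lambda>w. cinner w y)"
  have "linear_operator (graph_of (\<lambda>w. cinner w y))"
    by (simp add: linear_operator_def single_valued_def graph_of_def cinner_add_left
        cinner_scaleC_left scaleC_complex_def)
  then have "linear_operator F"
    unfolding F_def by (rule linear_operator_relcomp[OF jp_embedding(1)])
  moreover have "dense (Domain F)"
  proof -
    have "Domain F = Domain jp"
      by (auto simp: F_def graph_of_def)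
    then show ?thesis
      using jp_embedding(2) by simp
  qed
  moreover have "(0, 1) \<notin> closure F"
  proof -
    \<comment> \<open>The bound survives in the closure of the graph, where \<open>(0, 1)\<close>
      would need 1 <= 0.\<close>
    have "closed {p::'p \<times> complex. norm (snd p) \<le> norm v * norm (fst p)}"
      by (intro closed_Collect_le continuous_intros)
    then have "closure F \<subseteq> {p. norm (snd p) \<le> norm v * norm (fst p)}"
      by (intro closure_minimal) (auto simp: F_def graph_of_def cmod_cinner_le[OF v])
    then show ?thesis
      by auto
  qed
  ultimately obtain z where "\<And>x w. (x, w) \<in> F \<Longrightarrow> w = cinner x z"
    using riesz_representation by blast
  then have "(y, z) \<in> adjoint_operator jp"
    by (auto simp: adjoint_operator_iff F_def graph_of_def)
  then show "y \<in> Domain (adjoint_operator jp)"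
    by blast
qed

text \<open>Both sides are the norm of one functional, x -> <x, y> = <x, z>_+: (th3) reads it as
  \<open>norm v\<close>, and density of \<open>Domain jp\<close> makes it
  \<open>norm z\<close>.\<close>

lemma norm_adjoint_eq:
  assumes "(y, v) \<in> jm" "(y, z) \<in> adjoint_operator jp"
  shows "norm z = norm v"
proof (rule antisym)
  show "norm z \<le> norm v"
  proof (rule norm_le_of_dense[OF jp_embedding(2)])
    fix x assume "x \<in> Domain jp"
    then show "cmod (cinner x z) \<le> norm v * norm x"
      using cmod_cinner_le[OF assms(1)] adjoint_operatorD[OF assms(2)] by fastforce
  qed simp
  show "norm v \<le> norm z"
    by (rule norm_jm_le[OF assms(1)])
      (auto simp: adjoint_operatorD[OF assms(2)] norm_cinner_le mult.commute[of "norm z"])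
qed

text \<open>The same constant works in both directions: Cauchy-Schwarz bounds the supremum in (th3)
  by a multiple of \<open>norm y\<close>, and conversely testing x' against the dense domain of
  \<open>jm\<close> bounds \<open>norm x'\<close>.\<close>

lemma continuous_jp_iff_jm: "continuous_operator jp \<longleftrightarrow> continuous_operator jm"
  unfolding linear_operator_continuous_iff_bounded[OF jp_embedding(1)]
    linear_operator_continuous_iff_bounded[OF jm_embedding(1)]
proof safe
  fix C :: real assume C: "C \<ge> 0" "\<forall>(x, y)\<in>jp. norm y \<le> C * norm x"
  have "norm v \<le> C * norm y" if yv: "(y, v) \<in> jm" for y v
  proof (rule norm_jm_le[OF yv])
    fix x x' assume "(x, x') \<in> jp"
    then have "norm x' * norm y \<le> C * norm x * norm y"
      using C by (intro mult_right_mono) auto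
    then show "cmod (cinner x' y) \<le> C * norm y * norm x"
      using norm_cinner_le[of x' y] by (simp add: mult.assoc mult.commute[of "norm y"])
  qed (use C in simp)
  then show "\<exists>C\<ge>0. \<forall>(x, y)\<in>jm. norm y \<le> C * norm x"
    using C by auto
next
  fix C :: real assume C: "C \<ge> 0" "\<forall>(x, y)\<in>jm. norm y \<le> C * norm x"
  have "norm x' \<le> C * norm x" if xx': "(x, x') \<in> jp" for x x'
  proof (rule norm_le_of_dense[OF jm_embedding(2)])
    fix y assume "y \<in> Domain jm"
    then obtain v where v: "(y, v) \<in> jm"
      by blast
    have "cmod (cinner y x') = cmod (cinner x' y)"
      by (metis cinner_commute complex_mod_cnj)
    also have "\<dots> \<le> norm v * norm x"
      by (rule cmod_cinner_le[OF v xx'])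
    also have "\<dots> \<le> C * norm y * norm x"
      using C v by (intro mult_right_mono) auto
    finally show "cmod (cinner y x') \<le> C * norm x * norm y"
      by (simp add: mult.assoc mult.commute[of "norm y"])
  qed (use C in simp)
  then show "\<exists>C\<ge>0. \<forall>(x, y)\<in>jp. norm y \<le> C * norm x"
    using C by auto
qed

section \<open>Density in H_+\<close>

lemma orthogonal_Range_adjoint_eq_zero:
  assumes "\<And>h k. (h, k) \<in> adjoint_operator jp \<Longrightarrow> cinner k p = 0"
  shows "p = 0"
proof -
  \<comment> \<open>Decomposing \<open>(p, 0)\<close> gives w = -y, and orthogonality of p to z
    turns <x, z> into <z, z>. The adjoint relation then reads -|y|^2 = |z|^2, so y, z and w vanish,
    and injectivity of \<open>jp\<close> removes x.\<close>
  obtain x w y z where xw: "(x, w) \<in> jp" and yz: "(y, z) \<in> adjoint_operator jp"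
    and p: "p = x - z" and "0 = w + y"
    using graph_decomposition[OF jp_embedding(1), of p 0] unfolding closure_closed[OF jp_embedding(3)] by metis
  then have "w = - y" "cinner w y = cinner x z"
    by (simp_all add: eq_neg_iff_add_eq_0 adjoint_operatorD)
  moreover have "cinner p z = 0"
    using assms[OF yz] cinner_commute[of p z] by simp
  ultimately have "- cinner y y = cinner z z"
    by (simp add: p cinner_diff_left)
  then have "- (norm y)\<^sup>2 = (norm z)\<^sup>2"
    by (simp add: cinner_self complex_eq_iff)
  then have "(norm y)\<^sup>2 + (norm z)\<^sup>2 = 0"
    by linarith
  then have "y = 0" "z = 0"
    by (simp_all only: sum_power2_eq_zero_iff norm_eq_zero)
  then have "(0, x) \<in> jp\<inverse>" "(0, 0) \<in> jp\<inverse>"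
    using xw \<open>w = - y\<close> linear_operator_zero[OF jp_embedding(1)] by simp_all
  then have "x = 0"
    by (rule single_valuedD[OF jp_embedding(4)])
  then show ?thesis
    using p \<open>z = 0\<close> by simp
qed

text \<open>For \<open>B = j\<^sup>* j\<close>, \<open>(1 + B)\<^sup>-\<^sup>1\<close> maps the dense range of the adjoint \<open>j\<^sup>*\<close> into its intersection
  with the domain of \<open>j\<close>; moving \<open>(1 + B)\<^sup>-\<^sup>1\<close> to \<open>x\<close> gives the vector \<open>p\<close>, which is
  then orthogonal to the whole range of \<open>j\<^sup>*\<close>.\<close>

lemma orthogonal_Range_adjoint_Int_Domain_eq_zero:
  assumes "\<And>z y w. (y, z) \<in> adjoint_operator jp \<Longrightarrow> (z, w) \<in> jp \<Longrightarrow> cinner z x = 0"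
  shows "x = 0"
proof -
  note adj = linear_operator_adjoint[OF jp_embedding(2)]
  \<comment> \<open>Splitting \<open>(x, 0)\<close> yields x = p - z' with \<open>(q, - z')\<close>
    in the adjoint, that is, x = (1 + B) p.\<close>
  obtain p q y' z' where pq: "(p, q) \<in> jp" and yz': "(y', z') \<in> adjoint_operator jp"
    and x: "x = p - z'" and "0 = q + y'"
    using graph_decomposition[OF jp_embedding(1), of x 0] unfolding closure_closed[OF jp_embedding(3)] by metis
  then have q: "(q, - z') \<in> adjoint_operator jp"
    using linear_operator_diff[OF adj linear_operator_zero[OF adj] yz'] by (simp add: add_eq_0_iff2)
  have "cinner k p = 0" if hk: "(h, k) \<in> adjoint_operator jp" for h k
  proof -
    \<comment> \<open>It is \<open>h\<close> that is split, not \<open>k\<close>: this produces z =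
      (1 + B)^-1 k already in the range of the adjoint, so that the assumption on x applies to
      it.\<close>
    obtain y z w where yz: "(y, z) \<in> adjoint_operator jp" and zw: "(z, w) \<in> jp" and h: "h = y + w"
      using kernel_operator_onto[OF jp_embedding(1,3)] .
    have "(w, k - z) \<in> adjoint_operator jp"
      using linear_operator_diff[OF adj hk yz] h by simp
    then have "cinner q w = cinner p (k - z)"
      using pq by (rule adjoint_operatorD)
    then have "cinner w q = cinner (k - z) p"
      by (metis cinner_commute)
    moreover have "cinner w q = cinner z (- z')"
      using q zw by (rule adjoint_operatorD)
    ultimately have "cinner k p = cinner z x"
      by (simp add: x cinner_diff_left cinner_diff_right algebra_simps)
    then show ?thesis
      using assms[OF yz zw] by simp
  qed
  then have "p = 0"
    by (rule orthogonal_Range_adjoint_eq_zero)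
  moreover from this have "q = 0"
    using pq linear_operator_unique[OF jp_embedding(1) _ linear_operator_zero[OF jp_embedding(1)]] by simp
  moreover from this have "z' = 0"
    using q linear_operator_unique[OF adj _ linear_operator_zero[OF adj]] by force
  ultimately show ?thesis
    by (simp add: x)
qed

section \<open>Operators between H_- and H_+\<close>

definition dual_embedding :: "('m \<times> 'p) set" where
  "dual_embedding = jm\<inverse> O adjoint_operator jp"

text \<open>The kernel operator with arguments read in H_- and values read in H_+; its converse is
  then the Hamiltonian viewed from H_+ to H_-.\<close>

definition dual_kernel :: "('m \<times> 'p) set" where
  "dual_kernel = jm\<inverse> O kernel_operator jp O jp\<inverse>"

lemma linear_operator_dual_embedding: "linear_operator dual_embedding"
  unfolding dual_embedding_def
  by (intro linear_operator_relcomp linear_operator_converse linear_operator_adjoint jp_embedding jm_embedding)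

lemma single_valued_converse_dual_embedding: "single_valued (dual_embedding\<inverse>)"
  using jm_embedding(1) single_valued_converse_adjoint[OF jp_embedding(1,2,5)]
  by (auto simp: dual_embedding_def converse_relcomp linear_operator_def intro: single_valued_relcomp)

text \<open>Injectivity of \<open>jp\<close> cancels it against the trailing inverse of
  \<open>jp\<close>. Hence the kernel operator in this form is a restriction of the adjoint viewed
  on H_-, and the same unitary extends it.\<close>

lemma dual_kernel_iff: "(v, x) \<in> dual_kernel \<longleftrightarrow> (v, x) \<in> dual_embedding \<and> x \<in> Domain jp"
  using jp_embedding(4) by (auto simp: dual_kernel_def dual_embedding_def kernel_operator_def single_valued_def)

lemma converse_dual_kernel: "dual_kernel\<inverse> = jp O hamiltonian jp O jm"
  by (simp add: dual_kernel_def hamiltonian_def converse_relcomp O_assoc)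

lemma linear_operator_dual_kernel: "linear_operator dual_kernel"
  unfolding dual_kernel_def
  by (intro linear_operator_relcomp linear_operator_converse linear_operator_kernel_operator jp_embedding jm_embedding)

lemma linear_operator_converse_dual_kernel: "linear_operator (dual_kernel\<inverse>)"
proof (rule linear_operator_converse[OF linear_operator_dual_kernel])
  show "single_valued (dual_kernel\<inverse>)"
    using dual_kernel_iff by (intro single_valued_subset[OF _ single_valued_converse_dual_embedding]) auto
qed

lemma dense_Range_dual_kernel: "dense (Range dual_kernel)"
proof -
  \<comment> \<open>The density criterion speaks of domains, so it is applied to the converse. Each
    z in the range of the adjoint and in \<open>Domain jp\<close> is reached from H_- because (th3)
    puts the domain of the adjoint inside that of \<open>jm\<close>.\<close>
  have "dense (Domain (dual_kernel\<inverse>))"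
  proof (rule dense_Domain_if_orthogonal_eq_zero[OF linear_operator_converse_dual_kernel])
    fix x assume *: "\<And>z v. (z, v) \<in> dual_kernel\<inverse> \<Longrightarrow> cinner z x = 0"
    show "x = 0"
    proof (rule orthogonal_Range_adjoint_Int_Domain_eq_zero)
      fix z y w assume "(y, z) \<in> adjoint_operator jp" "(z, w) \<in> jp"
      moreover from this obtain v where "(y, v) \<in> jm"
        using Domain_adjoint_subset by blast
      ultimately have "(v, z) \<in> dual_kernel"
        by (auto simp: dual_kernel_iff dual_embedding_def)
      then show "cinner z x = 0"
        using * by blast
    qed
  qed
  then show ?thesis
    by simp
qed

lemma Domain_dual_embedding: "Domain dual_embedding = Range jm"
  using Domain_adjoint_eq by (auto simp: dual_embedding_def) blast

lemma dual_embedding_extends: "\<exists>U. extends_to_unitary dual_embedding U"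
proof (rule unitary_extension_exists[OF linear_operator_dual_embedding])
  show "dense (Domain dual_embedding)"
    by (simp add: Domain_dual_embedding jm_embedding)
  have "Range dual_kernel \<subseteq> Range dual_embedding"
    by (auto simp: dual_kernel_iff)
  then show "dense (Range dual_embedding)"
    using dense_Range_dual_kernel closure_mono unfolding dense_def by blast
  show "norm x = norm v" if "(v, x) \<in> dual_embedding" for v x
    using that norm_adjoint_eq by (auto simp: dual_embedding_def)
qed

lemma dual_embedding_extends_uniquely: "\<exists>!U. extends_to_unitary dual_embedding U"
proof -
  have "dense (Domain dual_embedding)"
    by (simp add: Domain_dual_embedding jm_embedding)
  then show ?thesis
    using dual_embedding_extends unitary_extension_unique by blast
qed

lemma dual_kernel_extends:
  "extends_to_unitary dual_embedding U \<Longrightarrow> extends_to_unitary dual_kernel U"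
  by (auto simp: extends_to_unitary_def dual_kernel_iff)

end

theorem theorem5p1:
  fixes jp :: "('p::complex_hilbert \<times> 'o::complex_hilbert) set"
    and jm :: "('o \<times> 'm::complex_hilbert) set"
    and A H :: "('o \<times> 'o) set"
    and V A' :: "('m \<times> 'p) set"
    and H' :: "('p \<times> 'm) set"
    and Vt :: "'m \<Rightarrow> 'p"
    and Ht :: "'p \<Rightarrow> 'm"
  assumes triplet: "closely_embedded_triplet jp jm"
    and A_eq: "A = kernel_operator jp"
    and H_eq: "H = hamiltonian jp"
    and V_eq: "V = jm\<inverse> O adjoint_operator jp"
    and Vt_eq: "Vt = (THE U. extends_to_unitary V U)"
    and A'_eq: "A' = jm\<inverse> O A O jp\<inverse>"
    and H'_eq: "H' = jp O H O jm"
    and Ht_eq: "Ht = (THE U. extends_to_unitary H' U)"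
  shows
    "(\<comment> \<open>(a)\<close>
      positive_operator A \<and> selfadjoint A \<and> \<not> eigenvalue A 0 \<and>
      positive_operator H \<and> selfadjoint H \<and> \<not> eigenvalue H 0)
   \<and> (\<comment> \<open>(b)\<close>
      Domain (adjoint_operator jp) = Domain jm \<and>
      (continuous_operator jp \<longleftrightarrow> continuous_operator jm) \<and>
      (\<exists>!U. extends_to_unitary V U))
   \<and> (\<comment> \<open>(c)\<close>
      Domain A \<subseteq> Domain jm \<and> Range A \<subseteq> Range jp \<and>
      linear_operator A' \<and> dense (Domain A') \<and> dense (Range A') \<and>
      A' \<subseteq> graph_of Vt)
   \<and> (\<comment> \<open>(d)\<close>
      Domain H \<subseteq> Range jp \<and> Range H \<subseteq> Domain jm \<and>
      linear_operator H' \<and> dense (Domain H') \<and> dense (Range H') \<and>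
      (\<exists>!U. extends_to_unitary H' U) \<and> Ht = inv Vt)
   \<and> (\<comment> \<open>(e)\<close>
      unitary_onto_conjugate_dual (\<lambda>y x. cinner (Vt y) x))"
proof -
  note T = jp_embedding[OF triplet] and M = jm_embedding[OF triplet]
  note V_eq = V_eq[folded dual_embedding_def[OF triplet]]
    and A'_eq = A'_eq[unfolded A_eq, folded dual_kernel_def[OF triplet]]
    and H'_eq = H'_eq[unfolded H_eq, folded converse_dual_kernel[OF triplet]]
  have A: "linear_operator A" "positive_operator A" "selfadjoint A" "single_valued (A\<inverse>)"
    unfolding A_eq using T
    by (simp_all add: linear_operator_kernel_operator positive_kernel_operator
        selfadjoint_kernel_operator single_valued_converse_kernel_operator)
  have H: "linear_operator H" "positive_operator H" "selfadjoint H" "single_valued (H\<inverse>)"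
    unfolding H_eq using T A(1)
    by (simp_all add: linear_operator_hamiltonian positive_hamiltonian selfadjoint_hamiltonian)
      (simp add: hamiltonian_def linear_operator_def A_eq)
  have a: "positive_operator A \<and> selfadjoint A \<and> \<not> eigenvalue A 0 \<and>
      positive_operator H \<and> selfadjoint H \<and> \<not> eigenvalue H 0"
    using A H by (simp add: zero_not_eigenvalue)
  have V: "\<exists>!U. extends_to_unitary V U"
    unfolding V_eq by (rule dual_embedding_extends_uniquely[OF triplet])
  then have Vt: "extends_to_unitary V Vt"
    unfolding Vt_eq by (rule theI')
  then have unitary: "unitary Vt"
    by (simp add: extends_to_unitary_def)
  have b: "Domain (adjoint_operator jp) = Domain jm \<and>
      (continuous_operator jp \<longleftrightarrow> continuous_operator jm) \<and> (\<exists>!U. extends_to_unitary V U)"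
    using Domain_adjoint_eq[OF triplet] continuous_jp_iff_jm[OF triplet] V by blast
  have DR: "Domain A \<subseteq> Domain jm" "Range A \<subseteq> Range jp"
    using Domain_adjoint_subset[OF triplet] by (auto simp: A_eq kernel_operator_def)
  have A'_ext: "extends_to_unitary A' Vt"
    using Vt unfolding A'_eq V_eq by (rule dual_kernel_extends[OF triplet])
  have A'_lin: "linear_operator A'" and A'_range: "dense (Range A')"
    unfolding A'_eq
    by (rule linear_operator_dual_kernel[OF triplet] dense_Range_dual_kernel[OF triplet])+
  have A'_domain: "dense (Domain A')"
    using A'_ext A'_range by (rule dense_Domain_if_dense_Range)
  have c: "Domain A \<subseteq> Domain jm \<and> Range A \<subseteq> Range jp \<and> linear_operator A' \<and>
      dense (Domain A') \<and> dense (Range A') \<and> A' \<subseteq> graph_of Vt"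
    using DR A'_lin A'_domain A'_range A'_ext by (simp add: extends_to_unitary_def)
  \<comment> \<open>Part (d) is part (c) inverted: passing to the converse exchanges the two density
    statements and replaces \<open>Vt\<close> by \<open>inv Vt\<close>.\<close>
  have H'_A': "H' = A'\<inverse>"
    by (simp add: H'_eq A'_eq)
  have H'_lin: "linear_operator H'"
    unfolding H'_eq by (rule linear_operator_converse_dual_kernel[OF triplet])
  have H'_dense: "dense (Domain H')" "dense (Range H')"
    using A'_domain A'_range by (simp_all add: H'_A')
  have H'_ext: "extends_to_unitary H' (inv Vt)"
    unfolding H'_A' using A'_ext by (rule extends_to_unitary_converse)
  have H'_unique: "\<exists>!U. extends_to_unitary H' U"
    using H'_ext unitary_extension_unique H'_dense(1) by blast
  have "Ht = inv Vt"
    unfolding Ht_eq by (rule the1_equality[OF H'_unique, OF H'_ext])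
  moreover have "Domain H \<subseteq> Range jp" "Range H \<subseteq> Domain jm"
    using DR by (simp_all add: H_eq A_eq hamiltonian_def)
  ultimately have d: "Domain H \<subseteq> Range jp \<and> Range H \<subseteq> Domain jm \<and> linear_operator H' \<and>
      dense (Domain H') \<and> dense (Range H') \<and> (\<exists>!U. extends_to_unitary H' U) \<and> Ht = inv Vt"
    using H'_lin H'_dense H'_unique by blast
  have e: "unitary_onto_conjugate_dual (\<lambda>y x. cinner (Vt y) x)"
    using unitary by (rule unitary_onto_conjugate_dual_cinner)
  show ?thesis
    using a b c d e by (intro conjI) blast+
qed

end
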